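(* Let $P$ be an interval order on a finite set $U$ whose composition matrix has dimension $m$, and let $C_{ij}=\{x\in U:(\ell(x),r(x))=(i,j)\}$, for $1\le i\le j\le m$, be its entries. A bijection $\sigma\colon U\to U$ is an automorphism of $P$ if and only if $\sigma(C_{ij})=C_{ij}$ for every entry. Thus $\mathrm{Aut}(P)$ is the Young subgroup $\prod_{1\le i\le j\le m}\mathrm{Sym}(C_{ij})$, where $\mathrm{Sym}(C)$ is the symmetric group on the set $C$.
   Context: A poset on a finite set $U$ is an irreflexive transitive relation $<$ on $U$. It is an interval order if it is $(2{+}2)$-free, i.e. has no induced subposet isomorphic to the disjoint union of two two-element chains. The strict down-set of $x$ is $D(x)=\{y:y<x\}$. In an interval order the distinct strict down-sets form a chain $D_1\subset D_2\subset\cdots\subset D_m$. For $x\in U$, the level $\ell(x)$ is the index with $D(x)=D_{\ell(x)}$, and $r(x)=\max\{k\in[m]:x\notin D_k\}$; one has $\ell(x)\le r(x)$. The composition matrix of $P$ is the upper triangular $m\times m$ matrix whose entry in position $(i,j)$ is the set of $x$ with $(\ell(x),r(x))=(i,j)$; its dimension $m$ is the number of distinct strict down-sets. An automorphism of $P$ is a bijection $\sigma\colon U\to U$ with $\{(\sigma x,\sigma y):x<y\}$ equal to the relation $<$. *)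

theory Defs
  imports "HOL-Algebra.Bij" "HOL-Algebra.Product_Groups"
begin

section \<open>Interval orders and their composition matrices\<close>

definition strict_poset_on :: "'a set \<Rightarrow> 'a rel \<Rightarrow> bool" where
  "strict_poset_on U R \<longleftrightarrow> R \<subseteq> U \<times> U \<and> irrefl_on U R \<and> trans R"

text \<open>The disjoint union of two two-element chains, on the points \<open>0, 1, 2, 3\<close>.\<close>

definition two_plus_two :: "nat rel" where
  "two_plus_two = {(0, 1), (2, 3)}"

definition interval_order :: "'a set \<Rightarrow> 'a rel \<Rightarrow> bool" where
  "interval_order U R \<longleftrightarrow>
     strict_poset_on U R \<and>
     \<not> (\<exists>f. inj_on f {..<4::nat} \<and> f ` {..<4} \<subseteq> U \<and>
            (\<forall>i<4. \<forall>j<4. (f i, f j) \<in> R \<longleftrightarrow> (i, j) \<in> two_plus_two))"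

definition strict_down_set :: "'a rel \<Rightarrow> 'a \<Rightarrow> 'a set" where
  "strict_down_set R x = {y. (y, x) \<in> R}"

definition strict_down_sets :: "'a set \<Rightarrow> 'a rel \<Rightarrow> 'a set set" where
  "strict_down_sets U R = strict_down_set R ` U"

definition composition_dim :: "'a set \<Rightarrow> 'a rel \<Rightarrow> nat" where
  "composition_dim U R = card (strict_down_sets U R)"

text \<open>
  The chain \<open>D\<^sub>1 \<subset> \<dots> \<subset> D\<^sub>m\<close> of all strict down-sets as a strictly increasing list; for a finite
  interval order it exists and is unique, see \<open>ex1_down_chain\<close> below.  List positions start
  at 0, the indices of the chain at 1.
\<close>

definition down_chain :: "'a set \<Rightarrow> 'a rel \<Rightarrow> 'a set list" where
  "down_chain U R = (THE Ds. sorted_wrt (\<subset>) Ds \<and> set Ds = strict_down_sets U R)"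

definition chain_set :: "'a set \<Rightarrow> 'a rel \<Rightarrow> nat \<Rightarrow> 'a set" where
  "chain_set U R k = down_chain U R ! (k - 1)"

definition level :: "'a set \<Rightarrow> 'a rel \<Rightarrow> 'a \<Rightarrow> nat" where
  "level U R x =
     (THE k. k \<in> {1..composition_dim U R} \<and> strict_down_set R x = chain_set U R k)"

definition rlevel :: "'a set \<Rightarrow> 'a rel \<Rightarrow> 'a \<Rightarrow> nat" where
  "rlevel U R x = Max {k \<in> {1..composition_dim U R}. x \<notin> chain_set U R k}"

definition composition_matrix :: "'a set \<Rightarrow> 'a rel \<Rightarrow> nat \<Rightarrow> nat \<Rightarrow> 'a set" where
  "composition_matrix U R i j = {x \<in> U. (level U R x, rlevel U R x) = (i, j)}"

definition upper_indices :: "nat \<Rightarrow> (nat \<times> nat) set" where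
  "upper_indices m = {(i, j). 1 \<le> i \<and> i \<le> j \<and> j \<le> m}"


section \<open>Automorphisms and Young subgroups\<close>

definition poset_automorphism :: "'a set \<Rightarrow> 'a rel \<Rightarrow> ('a \<Rightarrow> 'a) \<Rightarrow> bool" where
  "poset_automorphism U R \<sigma> \<longleftrightarrow> bij_betw \<sigma> U U \<and> {(\<sigma> x, \<sigma> y) | x y. (x, y) \<in> R} = R"

definition Aut :: "'a set \<Rightarrow> 'a rel \<Rightarrow> ('a \<Rightarrow> 'a) set" where
  "Aut U R = {\<sigma> \<in> Bij U. poset_automorphism U R \<sigma>}"

definition Aut_group :: "'a set \<Rightarrow> 'a rel \<Rightarrow> ('a \<Rightarrow> 'a) monoid" where
  "Aut_group U R = BijGroup U \<lparr>carrier := Aut U R\<rparr>"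

definition sym_product :: "'i set \<Rightarrow> ('i \<Rightarrow> 'a set) \<Rightarrow> ('i \<Rightarrow> 'a \<Rightarrow> 'a) monoid" where
  "sym_product I C = product_group I (\<lambda>p. BijGroup (C p))"

text \<open>
  For a partition \<open>C\<close> of \<open>U\<close> (empty blocks allowed), the Young subgroup is the product of the
  symmetric groups of the blocks, embedded in the symmetric group of \<open>U\<close>: a tuple \<open>\<tau>\<close> acts on
  each block \<open>C p\<close> by its component \<open>\<tau> p\<close>.
\<close>

definition young_subgroup :: "'a set \<Rightarrow> 'i set \<Rightarrow> ('i \<Rightarrow> 'a set) \<Rightarrow> ('a \<Rightarrow> 'a) set" where
  "young_subgroup U I C =
     {\<sigma> \<in> Bij U. \<exists>\<tau> \<in> carrier (sym_product I C). \<forall>p\<in>I. \<forall>x\<in>C p. \<sigma> x = \<tau> p x}"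

definition block_restriction :: "'i set \<Rightarrow> ('i \<Rightarrow> 'a set) \<Rightarrow> ('a \<Rightarrow> 'a) \<Rightarrow> 'i \<Rightarrow> 'a \<Rightarrow> 'a" where
  "block_restriction I C \<sigma> = (\<lambda>p\<in>I. restrict \<sigma> (C p))"


section \<open>Well-definedness\<close>

lemma down_sets_chain:
  assumes io: "interval_order U R" and x: "x \<in> U" and y: "y \<in> U"
  shows "strict_down_set R x \<subseteq> strict_down_set R y \<or> strict_down_set R y \<subseteq> strict_down_set R x"
proof (rule ccontr)
  assume "\<not> ?thesis"
  then obtain a b where a: "(a, x) \<in> R" "(a, y) \<notin> R" and b: "(b, y) \<in> R" "(b, x) \<notin> R"
    by (auto simp: strict_down_set_def)
  have R: "R \<subseteq> U \<times> U" "\<And>z. (z, z) \<notin> R" "\<And>u v w. (u, v) \<in> R \<Longrightarrow> (v, w) \<in> R \<Longrightarrow> (u, w) \<in> R"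
    using io by (auto simp: interval_order_def strict_poset_on_def irrefl_on_def dest: transD)
  define f where "f = (\<lambda>i::nat. [a, x, b, y] ! i)"
  have f: "f 0 = a" "f 1 = x" "f (Suc 0) = x" "f 2 = b" "f 3 = y"
    by (auto simp: f_def)
  have four: "{..<4::nat} = {0, 1, 2, 3}"
    by auto
  have all4: "(\<forall>i<4. Q i) \<longleftrightarrow> Q 0 \<and> Q 1 \<and> Q 2 \<and> Q 3" for Q :: "nat \<Rightarrow> bool"
    using four by (metis insert_iff lessThan_iff empty_iff)
  have neq: "a \<noteq> x" "a \<noteq> b" "a \<noteq> y" "x \<noteq> b" "x \<noteq> y" "b \<noteq> y"
    using a b R by blast+
  have inj: "inj_on f {..<4}"
    using neq by (auto simp: four f)
  have sub: "f ` {..<4} \<subseteq> U"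
    using a b R(1) by (auto simp: four f)
  have no: "(x, a) \<notin> R" "(y, b) \<notin> R" "(a, b) \<notin> R" "(b, a) \<notin> R" "(x, b) \<notin> R"
    "(x, y) \<notin> R" "(y, a) \<notin> R" "(y, x) \<notin> R"
    using a b R(2,3) by blast+
  have "\<forall>i<4. \<forall>j<4. (f i, f j) \<in> R \<longleftrightarrow> (i, j) \<in> two_plus_two"
    unfolding all4 using a b no R(2) by (simp add: f two_plus_two_def)
  then show False
    using io inj sub unfolding interval_order_def by blast
qed

lemma ex1_down_chain:
  assumes fin: "finite U" and io: "interval_order U R"
  shows "\<exists>!Ds. sorted_wrt (\<subset>) Ds \<and> set Ds = strict_down_sets U R"
proof -
  let ?A = "strict_down_sets U R"
  have finA: "finite ?A"
    using fin by (simp add: strict_down_sets_def)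
  have chain: "E \<subseteq> F \<or> F \<subseteq> E" if "E \<in> ?A" "F \<in> ?A" for E F
    using that down_sets_chain[OF io] by (auto simp: strict_down_sets_def)
  have finE: "finite E" if "E \<in> ?A" for E
    using that io fin unfolding strict_down_sets_def strict_down_set_def
    by (auto simp: interval_order_def strict_poset_on_def intro: finite_subset[of _ U])
  have inj: "inj_on card ?A"
    by (rule inj_onI) (metis chain finE card_subset_eq)
  have less: "E \<subset> F \<longleftrightarrow> card E < card F" if "E \<in> ?A" "F \<in> ?A" for E F
    by (metis that chain finE psubset_card_mono less_imp_not_less nless_le
        subset_not_subset_eq)
  have sw: "sorted_wrt (\<subset>) Ds \<longleftrightarrow> sorted_wrt (<) (map card Ds)" if "set Ds = ?A" for Ds
    unfolding sorted_wrt_map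
    by (rule iffI; erule sorted_wrt_mono_rel[rotated]) (use that less in auto)
  show ?thesis
  proof (rule ex_ex1I)
    let ?Ds = "map (inv_into ?A card) (sorted_list_of_set (card ` ?A))"
    have s: "set ?Ds = ?A"
      using finA inj by (simp add: image_image)
    have "map card ?Ds = sorted_list_of_set (card ` ?A)"
      unfolding map_map using finA by (intro map_idI) (auto intro: f_inv_into_f)
    then have "sorted_wrt (\<subset>) ?Ds"
      using sw[OF s] by simp
    with s show "\<exists>Ds. sorted_wrt (\<subset>) Ds \<and> set Ds = ?A"
      by blast
  next
    fix Ds Es
    assume D: "sorted_wrt (\<subset>) Ds \<and> set Ds = ?A" and E: "sorted_wrt (\<subset>) Es \<and> set Es = ?A"
    have "map card Ds = map card Es"
      using D E sw by (intro strict_sorted_equal) auto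
    then show "Ds = Es"
      using D E inj by (metis map_inj_on Un_absorb)
  qed
qed

lemma chain_set:
  assumes fin: "finite U" and io: "interval_order U R"
  shows "bij_betw (chain_set U R) {1..composition_dim U R} (strict_down_sets U R)"
    and "\<lbrakk>1 \<le> i; i < j; j \<le> composition_dim U R\<rbrakk> \<Longrightarrow> chain_set U R i \<subset> chain_set U R j"
proof -
  let ?D = "down_chain U R" and ?m = "composition_dim U R"
  have D: "sorted_wrt (\<subset>) ?D" "set ?D = strict_down_sets U R"
    using theI'[OF ex1_down_chain[OF fin io]] unfolding down_chain_def by auto
  have dist: "distinct ?D"
    using D(1) unfolding distinct_conv_nth sorted_wrt_iff_nth_less
    by (metis nat_neq_iff order.irrefl)
  then have len: "length ?D = ?m"
    by (simp add: composition_dim_def flip: D(2) distinct_card)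
  show mono: "chain_set U R i \<subset> chain_set U R j" if "1 \<le> i" "i < j" "j \<le> ?m" for i j
    using that D(1) len by (auto simp: chain_set_def sorted_wrt_iff_nth_less)
  have "bij_betw (\<lambda>k. ?D ! k) {..<?m} (set ?D)"
    using bij_betw_nth[OF dist] len by simp
  moreover have "bij_betw (\<lambda>k. k - 1) {1..?m} {..<?m}"
    by (rule bij_betwI[of _ _ _ Suc]) auto
  ultimately show "bij_betw (chain_set U R) {1..?m} (strict_down_sets U R)"
    using D(2) bij_betw_trans[of "\<lambda>k. k - 1" "{1..?m}" "{..<?m}" "\<lambda>k. ?D ! k" "set ?D"]
    by (simp add: chain_set_def[abs_def] comp_def)
qed

lemma level:
  assumes fin: "finite U" and io: "interval_order U R" and x: "x \<in> U"
  shows "level U R x \<in> {1..composition_dim U R}"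
    and "strict_down_set R x = chain_set U R (level U R x)"
proof -
  have "\<exists>!k. k \<in> {1..composition_dim U R} \<and> strict_down_set R x = chain_set U R k"
  proof -
    have inj: "inj_on (chain_set U R) {1..composition_dim U R}"
      and im: "chain_set U R ` {1..composition_dim U R} = strict_down_sets U R"
      using chain_set(1)[OF fin io] by (auto simp: bij_betw_def)
    have "strict_down_set R x \<in> chain_set U R ` {1..composition_dim U R}"
      unfolding im using x by (simp add: strict_down_sets_def)
    then show ?thesis
      using inj_onD[OF inj] by (intro ex_ex1I) (blast, metis)
  qed
  from theI'[OF this] show "level U R x \<in> {1..composition_dim U R}"
    "strict_down_set R x = chain_set U R (level U R x)"
    unfolding level_def by auto
qed

lemma level_rlevel_upper:
  assumes fin: "finite U" and io: "interval_order U R" and x: "x \<in> U"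
  shows "(level U R x, rlevel U R x) \<in> upper_indices (composition_dim U R)"
proof -
  let ?K = "{k \<in> {1..composition_dim U R}. x \<notin> chain_set U R k}"
  have "x \<notin> strict_down_set R x"
    using io x by (auto simp: strict_down_set_def interval_order_def strict_poset_on_def irrefl_on_def)
  then have l: "level U R x \<in> ?K"
    using level[OF fin io x] by simp
  have "finite ?K"
    by simp
  then have "level U R x \<le> rlevel U R x" "rlevel U R x \<in> ?K"
    unfolding rlevel_def using l Max_ge Max_in by blast+
  then show ?thesis
    using l by (auto simp: upper_indices_def)
qed

lemma composition_matrix_partition:
  assumes "finite U" "interval_order U R"
  shows "(\<Union>(i, j)\<in>upper_indices (composition_dim U R). composition_matrix U R i j) = U"
    and "(i, j) \<noteq> (i', j') \<Longrightarrow> composition_matrix U R i j \<inter> composition_matrix U R i' j' = {}"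
proof -
  show "(\<Union>(i, j)\<in>upper_indices (composition_dim U R). composition_matrix U R i j) = U"
  proof (intro equalityI subsetI)
    fix x assume "x \<in> U"
    with level_rlevel_upper[OF assms, of x]
    show "x \<in> (\<Union>(i, j)\<in>upper_indices (composition_dim U R). composition_matrix U R i j)"
      by (intro UN_I[of "(level U R x, rlevel U R x)"]) (auto simp: composition_matrix_def)
  qed (auto simp: composition_matrix_def)
  show "(i, j) \<noteq> (i', j') \<Longrightarrow> composition_matrix U R i j \<inter> composition_matrix U R i' j' = {}"
    by (auto simp: composition_matrix_def)
qed

end

theory Submission
  imports Defs "HOL-Library.Disjoint_Sets"
begin

text \<open>
  An automorphism \<open>\<sigma>\<close> carries the strict down-set of \<open>x\<close> onto that of \<open>\<sigma> x\<close>, so it permutes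
  the chain \<open>D\<^sub>1 \<subset> \<dots> \<subset> D\<^sub>m\<close>. As the members of a chain of finite sets have distinct sizes and
  \<open>\<sigma>\<close> preserves size, it maps each \<open>D\<^sub>k\<close> onto itself (\<open>automorphism_fixes_chain_set\<close>). Both
  \<open>\<ell>(x)\<close> and \<open>r(x)\<close> are read off from the chain, the former through the down-set of \<open>x\<close> and the
  latter through membership of \<open>x\<close>, so \<open>\<sigma>\<close> preserves them and with them every matrix entry.

  Conversely, \<open>y\<close> lies in \<open>D\<^sub>k\<close> exactly for the indices \<open>k\<close> above \<open>r(y)\<close>, because the chain
  increases. Therefore \<open>y < x\<close> holds iff \<open>r(y) < \<ell>(x)\<close> (\<open>rel_iff_rlevel_less_level\<close>), and the
  order can be recovered from the position of each element in the matrix: a bijection that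
  respects positions respects the order.

  The group-theoretic part holds for any partition of any set. The permutations that stabilise
  every block form the Young subgroup, and restricting them to the blocks is an
  isomorphism onto the product of the symmetric groups: injective because the blocks cover the
  set, surjective because permutations of disjoint blocks can be glued.
\<close>

section \<open>Young subgroups of a partition\<close>

lemma Bij_restrict_block:
  assumes "\<sigma> \<in> Bij U" "A \<subseteq> U" "\<sigma> ` A = A"
  shows "restrict \<sigma> A \<in> Bij A"
proof -
  have "inj_on \<sigma> A"
    using assms by (auto simp: Bij_def bij_betw_def intro: inj_on_subset)
  then show ?thesis
    using assms(3) by (auto simp: Bij_def bij_betw_def)
qed

lemma sym_product_carrier: "carrier (sym_product I C) = (\<Pi>\<^sub>E p\<in>I. Bij (C p))"
  by (simp add: sym_product_def BijGroup_def)

lemma block_restriction_in_sym_product: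
  assumes "\<sigma> \<in> Bij U" "\<And>p. p \<in> I \<Longrightarrow> C p \<subseteq> U" "\<And>p. p \<in> I \<Longrightarrow> \<sigma> ` C p = C p"
  shows "block_restriction I C \<sigma> \<in> carrier (sym_product I C)"
  using assms Bij_restrict_block by (fastforce simp: sym_product_carrier block_restriction_def)

text \<open>
  In one direction the required tuple of block permutations is given by the restrictions of
  \<open>\<sigma>\<close> to the blocks.
\<close>

lemma young_subgroup_eq_stabilizer:
  assumes sub: "\<And>p. p \<in> I \<Longrightarrow> C p \<subseteq> U"
  shows "young_subgroup U I C = {\<sigma> \<in> Bij U. \<forall>p\<in>I. \<sigma> ` C p = C p}"
proof (intro equalityI subsetI)
  fix \<sigma> assume "\<sigma> \<in> young_subgroup U I C"
  then obtain \<tau> where \<sigma>: "\<sigma> \<in> Bij U" and \<tau>: "\<tau> \<in> carrier (sym_product I C)"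
    and eq: "\<And>p x. p \<in> I \<Longrightarrow> x \<in> C p \<Longrightarrow> \<sigma> x = \<tau> p x"
    unfolding young_subgroup_def by blast
  have "\<sigma> ` C p = C p" if p: "p \<in> I" for p
  proof -
    have "\<sigma> ` C p = \<tau> p ` C p"
      by (rule image_cong) (use eq p in auto)
    also have "\<dots> = C p"
      using \<tau> p by (auto simp: sym_product_carrier Bij_def bij_betw_def)
    finally show ?thesis .
  qed
  with \<sigma> show "\<sigma> \<in> {\<sigma> \<in> Bij U. \<forall>p\<in>I. \<sigma> ` C p = C p}"
    by blast
next
  fix \<sigma> assume "\<sigma> \<in> {\<sigma> \<in> Bij U. \<forall>p\<in>I. \<sigma> ` C p = C p}"
  then have \<sigma>: "\<sigma> \<in> Bij U" "block_restriction I C \<sigma> \<in> carrier (sym_product I C)"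
    using sub block_restriction_in_sym_product[of \<sigma> U I C] by auto
  moreover have "\<forall>p\<in>I. \<forall>x\<in>C p. \<sigma> x = block_restriction I C \<sigma> p x"
    by (simp add: block_restriction_def)
  ultimately show "\<sigma> \<in> young_subgroup U I C"
    unfolding young_subgroup_def by blast
qed

lemma subgroup_young_subgroup:
  assumes sub: "\<And>p. p \<in> I \<Longrightarrow> C p \<subseteq> U"
  shows "subgroup (young_subgroup U I C) (BijGroup U)"
proof -
  interpret group "BijGroup U"
    by (rule group_BijGroup)
  let ?Y = "{\<sigma> \<in> Bij U. \<forall>p\<in>I. \<sigma> ` C p = C p}"
  have "subgroup ?Y (BijGroup U)"
  proof (rule subgroupI)
    show "?Y \<subseteq> carrier (BijGroup U)"
      by (auto simp: BijGroup_def)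
    have "(\<lambda>x\<in>U. x) ` C p = C p" if "p \<in> I" for p
      using sub[OF that] by (force simp: image_iff)
    then show "?Y \<noteq> {}"
      using id_Bij by blast
  next
    fix \<sigma> assume \<sigma>: "\<sigma> \<in> ?Y"
    then have \<sigma>_im: "\<sigma> ` C p = C p" if "p \<in> I" for p
      using that by blast
    have "restrict (inv_into U \<sigma>) U ` C p = C p" if p: "p \<in> I" for p
    proof -
      have "restrict (inv_into U \<sigma>) U ` C p = inv_into U \<sigma> ` \<sigma> ` C p"
        unfolding \<sigma>_im[OF p] by (rule image_cong) (use sub[OF p] in auto)
      also have "\<dots> = C p"
        using \<sigma> sub[OF p] by (intro inv_into_image_cancel) (auto simp: Bij_def bij_betw_def)
      finally show ?thesis .
    qed
    then show "inv\<^bsub>BijGroup U\<^esub> \<sigma> \<in> ?Y"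
      using \<sigma> by (auto simp: inv_BijGroup restrict_inv_into_Bij)
  next
    fix \<sigma> \<rho> assume \<sigma>: "\<sigma> \<in> ?Y" and \<rho>: "\<rho> \<in> ?Y"
    have "compose U \<sigma> \<rho> ` C p = C p" if p: "p \<in> I" for p
    proof -
      have "compose U \<sigma> \<rho> ` C p = \<sigma> ` \<rho> ` C p"
        unfolding image_image by (rule image_cong) (use sub[OF p] in \<open>auto simp: compose_def\<close>)
      then show ?thesis
        using \<sigma> \<rho> p by simp
    qed
    then show "\<sigma> \<otimes>\<^bsub>BijGroup U\<^esub> \<rho> \<in> ?Y"
      using \<sigma> \<rho> by (auto simp: BijGroup_def compose_Bij)
  qed
  then show ?thesis
    using young_subgroup_eq_stabilizer[of I C U] sub by simp
qed

text \<open>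
  Surjectivity of the restriction map: each point of \<open>U\<close> lies in exactly one block and is moved
  by the component of that block. Distinct blocks have disjoint images, so the glued map is
  again bijective.
\<close>

lemma sym_product_glue:
  assumes un: "(\<Union>p\<in>I. C p) = U" and disj: "disjoint_family_on C I"
    and \<tau>: "\<tau> \<in> carrier (sym_product I C)"
  obtains \<sigma> where "\<sigma> \<in> young_subgroup U I C" "block_restriction I C \<sigma> = \<tau>"
proof -
  define \<sigma> where "\<sigma> = (\<lambda>x\<in>U. \<tau> (THE p. p \<in> I \<and> x \<in> C p) x)"
  have bij: "bij_betw (\<tau> p) (C p) (C p)" and ext: "\<tau> p \<in> extensional (C p)" if "p \<in> I" for p
    using \<tau> that by (auto simp: sym_product_carrier Bij_def)
  have \<tau>_ext: "\<tau> \<in> extensional I"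
    using \<tau> by (auto simp: sym_product_carrier PiE_def)
  have eq: "\<sigma> x = \<tau> p x" if "p \<in> I" "x \<in> C p" for p x
  proof -
    have "(THE p. p \<in> I \<and> x \<in> C p) = p"
      using that disj by (intro the_equality) (auto simp: disjoint_family_on_def)
    then show ?thesis
      using that un by (auto simp: \<sigma>_def)
  qed
  have "bij_betw \<sigma> (\<Union>p\<in>I. C p) (\<Union>p\<in>I. C p)"
  proof (rule bij_betw_UNION_disjoint[OF disj])
    show "bij_betw \<sigma> (C p) (C p)" if "p \<in> I" for p
      using bij[OF that] eq[OF that] by (simp cong: bij_betw_cong)
  qed
  then have "\<sigma> \<in> Bij U"
    using un by (auto simp: Bij_def \<sigma>_def)
  then have "\<sigma> \<in> young_subgroup U I C"
    using \<tau> eq unfolding young_subgroup_def by blast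
  moreover have "block_restriction I C \<sigma> = \<tau>"
  proof (rule extensionalityI[OF _ \<tau>_ext])
    show "block_restriction I C \<sigma> \<in> extensional I"
      by (simp add: block_restriction_def)
    show "block_restriction I C \<sigma> p = \<tau> p" if p: "p \<in> I" for p
      by (rule extensionalityI[OF _ ext[OF p]])
        (use p eq in \<open>auto simp: block_restriction_def\<close>)
  qed
  ultimately show thesis
    by (rule that)
qed

lemma block_restriction_iso:
  assumes un: "(\<Union>p\<in>I. C p) = U" and disj: "disjoint_family_on C I"
  shows "block_restriction I C
    \<in> iso (BijGroup U \<lparr>carrier := young_subgroup U I C\<rparr>) (sym_product I C)"
proof -
  let ?Y = "young_subgroup U I C" and ?f = "block_restriction I C"
  have sub: "C p \<subseteq> U" if "p \<in> I" for p
    using un that by blast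
  have Y: "\<sigma> \<in> ?Y \<longleftrightarrow> \<sigma> \<in> Bij U \<and> (\<forall>p\<in>I. \<sigma> ` C p = C p)" for \<sigma>
    using young_subgroup_eq_stabilizer[of I C U] sub by auto
  have into: "?f \<sigma> \<in> carrier (sym_product I C)" if "\<sigma> \<in> ?Y" for \<sigma>
    using that block_restriction_in_sym_product[of \<sigma> U I C] sub by (auto simp: Y)
  have mult: "?f (compose U \<sigma> \<rho>) = ?f \<sigma> \<otimes>\<^bsub>sym_product I C\<^esub> ?f \<rho>" if "\<sigma> \<in> ?Y" "\<rho> \<in> ?Y" for \<sigma> \<rho>
  proof -
    have "restrict (compose U \<sigma> \<rho>) (C p) = compose (C p) (restrict \<sigma> (C p)) (restrict \<rho> (C p))"
      if p: "p \<in> I" for p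
    proof -
      have "\<rho> x \<in> C p" if "x \<in> C p" for x
        using \<open>\<rho> \<in> ?Y\<close> p that unfolding Y by blast
      then show ?thesis
        using sub[OF p] by (auto simp: compose_def restrict_def fun_eq_iff)
    qed
    moreover have "restrict \<sigma> (C p) \<in> Bij (C p)" "restrict \<rho> (C p) \<in> Bij (C p)" if "p \<in> I" for p
      using \<open>\<sigma> \<in> ?Y\<close> \<open>\<rho> \<in> ?Y\<close> that sub[OF that]
      by (simp_all add: Y Bij_restrict_block[of _ U])
    ultimately show ?thesis
      by (auto simp: sym_product_def block_restriction_def BijGroup_def intro!: restrict_ext)
  qed
  have inj: "inj_on ?f ?Y"
  proof (rule inj_onI)
    fix \<sigma> \<rho> assume s: "\<sigma> \<in> ?Y" "\<rho> \<in> ?Y" "?f \<sigma> = ?f \<rho>"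
    have "\<sigma> x = \<rho> x" if "x \<in> U" for x
    proof -
      obtain p where p: "p \<in> I" "x \<in> C p"
        using un \<open>x \<in> U\<close> by blast
      have "?f \<sigma> p x = ?f \<rho> p x"
        using s(3) by simp
      then show ?thesis
        using p by (simp add: block_restriction_def)
    qed
    moreover have "\<sigma> \<in> extensional U" "\<rho> \<in> extensional U"
      using s by (auto simp: Y Bij_def)
    ultimately show "\<sigma> = \<rho>"
      by (intro extensionalityI[of _ U])
  qed
  have "?f ` ?Y = carrier (sym_product I C)"
    using into sym_product_glue[OF un disj] by blast
  moreover have "?f \<in> hom (BijGroup U \<lparr>carrier := ?Y\<rparr>) (sym_product I C)"
    using into mult by (intro homI) (auto simp: BijGroup_def Y)
  ultimately show ?thesis
    using inj by (simp add: iso_def bij_betw_def)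
qed


section \<open>Automorphisms of an interval order\<close>

lemma rel_iff_mem_strict_down_set: "(y, x) \<in> R \<longleftrightarrow> y \<in> strict_down_set R x"
  by (simp add: strict_down_set_def)

text \<open>The indices \<open>k\<close> with \<open>x \<notin> D\<^sub>k\<close> form an initial segment of the chain, whose end is \<open>r(x)\<close>.\<close>

lemma mem_chain_set_iff:
  assumes fin: "finite U" and io: "interval_order U R" and x: "x \<in> U"
    and k: "k \<in> {1..composition_dim U R}"
  shows "x \<in> chain_set U R k \<longleftrightarrow> rlevel U R x < k"
proof -
  let ?K = "{k \<in> {1..composition_dim U R}. x \<notin> chain_set U R k}"
  have irr: "x \<notin> strict_down_set R x"
    using io by (auto simp: strict_down_set_def interval_order_def strict_poset_on_def irrefl_on_def)
  \<comment> \<open>The maximum is over a nonempty set: \<open>x\<close> is not in its own down-set \<open>D\<^bsub>\<ell>(x)\<^esub>\<close>.\<close>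
  then have "level U R x \<in> ?K"
    using level[OF fin io x] by auto
  then have r: "rlevel U R x \<in> ?K"
    unfolding rlevel_def by (intro Max_in) auto
  have le: "j \<le> rlevel U R x" if "j \<in> ?K" for j
    unfolding rlevel_def using that by (intro Max_ge) auto
  show ?thesis
  proof
    assume "x \<in> chain_set U R k"
    then show "rlevel U R x < k"
      using r k chain_set(2)[OF fin io, of k "rlevel U R x"]
      by (cases "rlevel U R x" k rule: linorder_cases) auto
  next
    assume "rlevel U R x < k"
    then show "x \<in> chain_set U R k"
      using le[of k] k by auto
  qed
qed

text \<open>
  The matrix determines the order: \<open>y < x\<close> says that \<open>y\<close> lies in the member \<open>D\<^bsub>\<ell>(x)\<^esub>\<close> of the
  chain, that is, \<open>\<ell>(x)\<close> is beyond the initial segment of indices that ends at \<open>r(y)\<close>.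
\<close>

lemma rel_iff_rlevel_less_level:
  assumes fin: "finite U" and io: "interval_order U R" and x: "x \<in> U" and y: "y \<in> U"
  shows "(y, x) \<in> R \<longleftrightarrow> rlevel U R y < level U R x"
  using level[OF fin io x] mem_chain_set_iff[OF fin io y]
  by (simp add: rel_iff_mem_strict_down_set)

lemma poset_automorphism_iff:
  assumes bij: "bij_betw \<sigma> U U" and R: "R \<subseteq> U \<times> U"
  shows "poset_automorphism U R \<sigma> \<longleftrightarrow> (\<forall>x\<in>U. \<forall>y\<in>U. (\<sigma> x, \<sigma> y) \<in> R \<longleftrightarrow> (x, y) \<in> R)"
proof
  have inj: "inj_on \<sigma> U" and im: "\<sigma> ` U = U"
    using bij by (auto simp: bij_betw_def)
  {
    assume "poset_automorphism U R \<sigma>"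
    then have e: "{(\<sigma> x, \<sigma> y) | x y. (x, y) \<in> R} = R"
      by (simp add: poset_automorphism_def)
    show "\<forall>x\<in>U. \<forall>y\<in>U. (\<sigma> x, \<sigma> y) \<in> R \<longleftrightarrow> (x, y) \<in> R"
    proof (intro ballI iffI)
      fix x y assume xy: "x \<in> U" "y \<in> U" "(\<sigma> x, \<sigma> y) \<in> R"
      then obtain x' y' where "(x', y') \<in> R" "\<sigma> x = \<sigma> x'" "\<sigma> y = \<sigma> y'"
        using e by blast
      moreover from this have "x = x'" "y = y'"
        using xy R inj_onD[OF inj] by blast+
      ultimately show "(x, y) \<in> R"
        by simp
    qed (use e in blast)
  next
    assume p: "\<forall>x\<in>U. \<forall>y\<in>U. (\<sigma> x, \<sigma> y) \<in> R \<longleftrightarrow> (x, y) \<in> R"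
    have "{(\<sigma> x, \<sigma> y) | x y. (x, y) \<in> R} = R"
    proof (intro equalityI subsetI)
      fix z assume z: "z \<in> R"
      then have "z \<in> \<sigma> ` U \<times> \<sigma> ` U"
        using R im by auto
      then obtain x y where "z = (\<sigma> x, \<sigma> y)" "x \<in> U" "y \<in> U"
        by blast
      then show "z \<in> {(\<sigma> x, \<sigma> y) | x y. (x, y) \<in> R}"
        using p z by blast
    qed (use p R in blast)
    then show "poset_automorphism U R \<sigma>"
      using bij by (simp add: poset_automorphism_def)
  }
qed

lemma automorphism_strict_down_set:
  assumes R: "R \<subseteq> U \<times> U" and aut: "poset_automorphism U R \<sigma>" and x: "x \<in> U"
  shows "strict_down_set R (\<sigma> x) = \<sigma> ` strict_down_set R x"
proof -
  have bij: "bij_betw \<sigma> U U"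
    using aut by (simp add: poset_automorphism_def)
  then have im: "\<sigma> ` U = U"
    by (simp add: bij_betw_def)
  have iff: "(\<sigma> y, \<sigma> x) \<in> R \<longleftrightarrow> (y, x) \<in> R" if "y \<in> U" for y
    using aut x that by (simp add: poset_automorphism_iff[OF bij R])
  show ?thesis
  proof (intro equalityI subsetI)
    fix z assume z: "z \<in> strict_down_set R (\<sigma> x)"
    then have "z \<in> \<sigma> ` U"
      using R im by (auto simp: strict_down_set_def)
    then show "z \<in> \<sigma> ` strict_down_set R x"
      using z iff by (auto simp: strict_down_set_def)
  qed (use R iff in \<open>auto simp: strict_down_set_def\<close>)
qed

text \<open>
  The image of \<open>D\<^sub>k\<close> is again a down-set, hence comparable with \<open>D\<^sub>k\<close>, and it has the same finite
  size.
\<close>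

lemma automorphism_fixes_chain_set:
  assumes fin: "finite U" and io: "interval_order U R" and aut: "poset_automorphism U R \<sigma>"
    and k: "k \<in> {1..composition_dim U R}"
  shows "\<sigma> ` chain_set U R k = chain_set U R k"
proof -
  have R: "R \<subseteq> U \<times> U"
    using io by (simp add: interval_order_def strict_poset_on_def)
  have bij: "inj_on \<sigma> U" "\<sigma> ` U = U"
    using aut by (auto simp: poset_automorphism_def bij_betw_def)
  have "chain_set U R k \<in> strict_down_sets U R"
    using chain_set(1)[OF fin io] k by (auto simp: bij_betw_def)
  then obtain x where x: "x \<in> U" "chain_set U R k = strict_down_set R x"
    by (auto simp: strict_down_sets_def)
  let ?D = "strict_down_set R x"
  have D: "?D \<subseteq> U"
    using R by (auto simp: strict_down_set_def)
  have "\<sigma> x \<in> U"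
    using bij(2) x(1) by blast
  then have "\<sigma> ` ?D \<subseteq> ?D \<or> ?D \<subseteq> \<sigma> ` ?D"
    using down_sets_chain[OF io _ x(1), of "\<sigma> x"] automorphism_strict_down_set[OF R aut x(1)]
    by simp
  moreover have "card (\<sigma> ` ?D) = card ?D" "finite ?D"
    using D bij(1) fin by (auto intro: card_image inj_on_subset finite_subset)
  ultimately have "\<sigma> ` ?D = ?D"
    by (metis card_subset_eq finite_imageI)
  then show ?thesis
    by (simp add: x(2))
qed

text \<open>
  An automorphism fixes every \<open>D\<^sub>k\<close> as a set, in particular the down-set of \<open>x\<close>, which is
  therefore also the down-set of \<open>\<sigma> x\<close>; and \<open>x\<close> and \<open>\<sigma> x\<close> lie in the same members of the chain.
\<close>

lemma automorphism_iff_preserves_levels: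
  assumes fin: "finite U" and io: "interval_order U R" and bij: "bij_betw \<sigma> U U"
  shows "poset_automorphism U R \<sigma> \<longleftrightarrow>
    (\<forall>x\<in>U. level U R (\<sigma> x) = level U R x \<and> rlevel U R (\<sigma> x) = rlevel U R x)"
proof
  have R: "R \<subseteq> U \<times> U"
    using io by (simp add: interval_order_def strict_poset_on_def)
  have \<sigma>U: "\<sigma> x \<in> U" if "x \<in> U" for x
    using bij that by (auto simp: bij_betw_def)
  {
    assume aut: "poset_automorphism U R \<sigma>"
    note fixed = automorphism_fixes_chain_set[OF fin io aut]
    show "\<forall>x\<in>U. level U R (\<sigma> x) = level U R x \<and> rlevel U R (\<sigma> x) = rlevel U R x"
    proof (intro ballI conjI)
      fix x assume x: "x \<in> U"
      have "strict_down_set R (\<sigma> x) = strict_down_set R x"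
        using automorphism_strict_down_set[OF R aut x] level[OF fin io x] fixed by simp
      then show "level U R (\<sigma> x) = level U R x"
        by (simp add: level_def)
      have "\<sigma> x \<in> chain_set U R k \<longleftrightarrow> x \<in> chain_set U R k"
        if k: "k \<in> {1..composition_dim U R}" for k
      proof -
        have "chain_set U R k \<in> strict_down_sets U R"
          using chain_set(1)[OF fin io] k by (auto simp: bij_betw_def)
        then have "chain_set U R k \<subseteq> U"
          using R by (auto simp: strict_down_sets_def strict_down_set_def)
        moreover have "inj_on \<sigma> U"
          using bij by (simp add: bij_betw_def)
        ultimately have "\<sigma> x \<in> \<sigma> ` chain_set U R k \<longleftrightarrow> x \<in> chain_set U R k"
          using x by (intro inj_on_image_mem_iff)
        then show ?thesis
          using fixed[OF k] by simp
      qed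
      then have "{k \<in> {1..composition_dim U R}. \<sigma> x \<notin> chain_set U R k}
               = {k \<in> {1..composition_dim U R}. x \<notin> chain_set U R k}"
        by blast
      then show "rlevel U R (\<sigma> x) = rlevel U R x"
        by (simp add: rlevel_def)
    qed
  next
    assume "\<forall>x\<in>U. level U R (\<sigma> x) = level U R x \<and> rlevel U R (\<sigma> x) = rlevel U R x"
    then show "poset_automorphism U R \<sigma>"
      unfolding poset_automorphism_iff[OF bij R]
      using rel_iff_rlevel_less_level[OF fin io] \<sigma>U by simp
  }
qed

lemma automorphism_iff_fixes_entries:
  assumes fin: "finite U" and io: "interval_order U R" and bij: "bij_betw \<sigma> U U"
  shows "poset_automorphism U R \<sigma> \<longleftrightarrow>
    (\<forall>(i, j)\<in>upper_indices (composition_dim U R).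
       \<sigma> ` composition_matrix U R i j = composition_matrix U R i j)"
    (is "_ \<longleftrightarrow> (\<forall>(i, j)\<in>?I. \<sigma> ` ?C i j = ?C i j)")
  unfolding automorphism_iff_preserves_levels[OF assms]
proof
  assume p: "\<forall>x\<in>U. level U R (\<sigma> x) = level U R x \<and> rlevel U R (\<sigma> x) = rlevel U R x"
  \<comment> \<open>Preservation of levels gives only one inclusion; equality follows since blocks are finite.\<close>
  have "\<sigma> ` ?C i j = ?C i j" for i j
  proof (rule card_subset_eq)
    show "finite (?C i j)"
      using fin by (simp add: composition_matrix_def)
    show "\<sigma> ` ?C i j \<subseteq> ?C i j"
      using p bij by (auto simp: composition_matrix_def bij_betw_def)
    show "card (\<sigma> ` ?C i j) = card (?C i j)"
      by (rule card_image, rule inj_on_subset[of _ U])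
        (use bij in \<open>auto simp: composition_matrix_def bij_betw_def\<close>)
  qed
  then show "\<forall>(i, j)\<in>?I. \<sigma> ` ?C i j = ?C i j"
    by blast
next
  assume p: "\<forall>(i, j)\<in>?I. \<sigma> ` ?C i j = ?C i j"
  show "\<forall>x\<in>U. level U R (\<sigma> x) = level U R x \<and> rlevel U R (\<sigma> x) = rlevel U R x"
  proof
    fix x assume x: "x \<in> U"
    then have "x \<in> ?C (level U R x) (rlevel U R x)"
      by (simp add: composition_matrix_def)
    then have "\<sigma> x \<in> ?C (level U R x) (rlevel U R x)"
      using p level_rlevel_upper[OF fin io x] by blast
    then show "level U R (\<sigma> x) = level U R x \<and> rlevel U R (\<sigma> x) = rlevel U R x"
      by (simp add: composition_matrix_def)
  qed
qed

theorem corollary7p1: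
  fixes U :: "'a set" and R :: "'a rel" and m :: nat and C :: "nat \<Rightarrow> nat \<Rightarrow> 'a set"
  assumes "finite U"
    and "interval_order U R"
    and "m = composition_dim U R"
    and "C = composition_matrix U R"
  shows "(\<forall>\<sigma>. bij_betw \<sigma> U U \<longrightarrow>
            (poset_automorphism U R \<sigma> \<longleftrightarrow>
               (\<forall>i j. 1 \<le> i \<and> i \<le> j \<and> j \<le> m \<longrightarrow> \<sigma> ` C i j = C i j)))
       \<and> subgroup (Aut U R) (BijGroup U)
       \<and> Aut U R = young_subgroup U (upper_indices m) (\<lambda>(i, j). C i j)
       \<and> block_restriction (upper_indices m) (\<lambda>(i, j). C i j)
           \<in> iso (Aut_group U R) (sym_product (upper_indices m) (\<lambda>(i, j). C i j))"
proof -
  let ?I = "upper_indices m" and ?C = "\<lambda>(i, j). C i j"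
  have iff: "poset_automorphism U R \<sigma> \<longleftrightarrow> (\<forall>p\<in>?I. \<sigma> ` ?C p = ?C p)"
    if "bij_betw \<sigma> U U" for \<sigma>
    using automorphism_iff_fixes_entries[OF assms(1,2) that] assms(3,4)
    by (simp add: case_prod_beta)
  have un: "(\<Union>p\<in>?I. ?C p) = U"
    using composition_matrix_partition(1)[OF assms(1,2)] assms(3,4) by simp
  have disj: "disjoint_family_on ?C ?I"
    using composition_matrix_partition(2)[OF assms(1,2)] assms(4)
    by (auto simp: disjoint_family_on_def split: prod.splits)
  have sub: "?C p \<subseteq> U" if "p \<in> ?I" for p
    using un that by blast
  have Aut: "Aut U R = young_subgroup U ?I ?C"
  proof -
    have "Aut U R = {\<sigma> \<in> Bij U. \<forall>p\<in>?I. \<sigma> ` ?C p = ?C p}"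
      unfolding Aut_def by (rule Collect_cong) (metis (no_types, lifting) iff Bij_def IntE mem_Collect_eq)
    also have "\<dots> = young_subgroup U ?I ?C"
      using young_subgroup_eq_stabilizer[of ?I ?C U] sub by presburger
    finally show ?thesis .
  qed
  have "\<forall>\<sigma>. bij_betw \<sigma> U U \<longrightarrow> (poset_automorphism U R \<sigma> \<longleftrightarrow>
      (\<forall>i j. 1 \<le> i \<and> i \<le> j \<and> j \<le> m \<longrightarrow> \<sigma> ` C i j = C i j))"
    using iff by (auto simp: upper_indices_def)
  moreover have "subgroup (Aut U R) (BijGroup U)"
    unfolding Aut using sub by (rule subgroup_young_subgroup)
  moreover have "block_restriction ?I ?C \<in> iso (Aut_group U R) (sym_product ?I ?C)"
    unfolding Aut_group_def Aut using un disj by (rule block_restriction_iso)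
  ultimately show ?thesis
    using Aut by blast
qed

end
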